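(* Let $Q\in\mathbb R^{n\times l}$ be a random orthonormal sketch matrix (so $Q^TQ=I_l$), where $l=\lceil p_{\mathrm{sketch}}\,n\rceil$. Every set of $l$ columns in $Q^T$ is linearly independent. That is, $\operatorname{spark}(Q^T)=l+1$ almost surely.
   Context: Here $n$ is the dimension of the domain of a weight matrix (its row length), $p_{\mathrm{sketch}}\in(0,1]$ is the sketch fraction, and $I_l$ is the $l\times l$ identity matrix. A parameter sketch of a weight matrix $\theta$ is the projection $\theta Q$; the matrix $Q$ is a random orthonormal matrix that is held fixed once chosen. The spark of a matrix is the smallest number of its columns that are linearly dependent. *)

theory Defs
  imports "HOL-Probability.Probability"
begin

text \<open>
  The uniform distribution on the \<open>n \<times> l\<close> matrices with orthonormal columns (the Stiefel
  manifold) is the unique Borel probability measure there that is invariant under left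
  multiplication by orthogonal \<open>n \<times> n\<close> matrices. The distribution is part of what "random"
  means: orthonormality of the columns alone does not exclude, say, a point mass at a matrix
  with a zero row.
\<close>

definition random_orthonormal ::
    "'a measure \<Rightarrow> ('a \<Rightarrow> real ^ 'l ^ 'n) \<Rightarrow> bool" where
  "random_orthonormal M Q \<longleftrightarrow>
     Q \<in> borel_measurable M \<and>
     (AE \<omega> in M. transpose (Q \<omega>) ** Q \<omega> = mat 1) \<and>
     (\<forall>U :: real ^ 'n ^ 'n. orthogonal_matrix U \<longrightarrow>
        distr M borel (\<lambda>\<omega>. U ** Q \<omega>) = distr M borel Q)"

text \<open>
  Sets of columns are given by sets of column indices. The injectivity condition makes two equal
  columns at different positions count as linearly dependent; the image set alone would
  identify them.
\<close>

definition independent_columns :: "real ^ 'c ^ 'r \<Rightarrow> 'c set \<Rightarrow> bool" where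
  "independent_columns A S \<longleftrightarrow>
     inj_on (\<lambda>j. column j A) S \<and> independent ((\<lambda>j. column j A) ` S)"

text \<open>
  If all columns together are linearly independent, no dependent set exists and the spark is by
  convention the number of columns plus one. For an \<open>l \<times> n\<close> matrix this can only
  happen when \<open>n \<le> l\<close>.
\<close>

definition spark :: "real ^ 'c ^ 'r \<Rightarrow> nat" where
  "spark A =
     (if \<exists>S. \<not> independent_columns A S
      then (LEAST k. \<exists>S. card S = k \<and> \<not> independent_columns A S)
      else CARD('c) + 1)"

end

theory Submission
  imports Defs
begin

text \<open>
  Fix two sets of \<open>l\<close> rows that differ by exchanging row \<open>i\<close> for row \<open>j\<close>, with
  minors \<open>x\<close> and \<open>y\<close>. Rotating the plane of the coordinates \<open>i\<close> and \<open>j\<close> rotates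
  the vector \<open>(x, y)\<close>, so the events that the first minor vanishes and the second does not, taken
  after rotations with different slopes, are pairwise disjoint. By invariance they have the same
  probability, and infinitely many of them fit into a probability space, so each is null. Hence
  almost surely the sets of rows with nonzero minor are closed under exchange. There is such a set,
  because the matrix has rank \<open>l\<close>, and exchanges lead from it to every other set of \<open>l\<close> rows.
\<close>

section \<open>Minors under plane rotations\<close>

text \<open>Rows are selected by a function instead of a set: they then form a square matrix indexed
  by \<open>'l\<close>, and an exchange of rows is a function update. For injective
  \<open>f\<close>, another order of the same rows changes at most the sign, so whether the minor
  vanishes depends only on \<open>range f\<close>.\<close>

definition row_minor :: "('l \<Rightarrow> 'n) \<Rightarrow> real ^ 'l ^ 'n \<Rightarrow> real" where
  "row_minor f X = det (\<chi> a. X $ f a)"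

text \<open>A Givens rotation once \<open>c\<^sup>2 + s\<^sup>2 = 1\<close>, with \<open>c\<close>
  and \<open>s\<close> in place of the cosine and sine of an angle.\<close>

definition plane_rotation :: "real \<Rightarrow> real \<Rightarrow> 'n \<Rightarrow> 'n \<Rightarrow> real ^ 'n ^ 'n" where
  "plane_rotation c s i j = (\<chi> a b.
     if a = i then (if b = i then c else if b = j then s else 0)
     else if a = j then (if b = i then - s else if b = j then c else 0)
     else if a = b then 1 else 0)"

lemma plane_rotation_mult:
  fixes X :: "real ^ 'l ^ 'n"
  assumes "i \<noteq> j"
  shows "(plane_rotation c s i j ** X) $ a =
    (if a = i then c *\<^sub>R X $ i + s *\<^sub>R X $ j
     else if a = j then c *\<^sub>R X $ j - s *\<^sub>R X $ i
     else X $ a)"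
proof -
  have two: "(\<Sum>k\<in>UNIV. (if k = i then u else if k = j then v else 0) * X $ k $ b)
      = u * X $ i $ b + v * X $ j $ b" for u v b
  proof -
    have "(\<Sum>k\<in>UNIV. (if k = i then u else if k = j then v else 0) * X $ k $ b)
      = (\<Sum>k\<in>UNIV. (if k = i then u * X $ k $ b else 0) + (if k = j then v * X $ k $ b else 0))"
      using assms by (intro sum.cong) auto
    then show ?thesis
      by (simp add: sum.distrib)
  qed
  have one: "(\<Sum>k\<in>UNIV. (if a = k then 1 else 0) * X $ k $ b) = X $ a $ b" for b
    by (simp add: if_distrib[of "\<lambda>x. x * _"] cong: if_cong)
  show ?thesis
    using assms
    by (auto simp: vec_eq_iff plane_rotation_def matrix_matrix_mult_def two one)
qed

lemma transpose_plane_rotation: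
  assumes "i \<noteq> j"
  shows "transpose (plane_rotation c s i j) = plane_rotation c (- s) i j"
  using assms by (auto simp: vec_eq_iff plane_rotation_def transpose_def)

lemma orthogonal_plane_rotation:
  fixes i j :: "'n::finite"
  assumes "i \<noteq> j" and "c\<^sup>2 + s\<^sup>2 = 1"
  shows "orthogonal_matrix (plane_rotation c s i j)"
proof -
  have "(plane_rotation c (- s) i j ** plane_rotation c s i j) $ a $ b = mat 1 $ a $ b" for a b
    unfolding plane_rotation_mult[OF assms(1)]
    using assms
    by (simp add: plane_rotation_def mat_def power2_eq_square algebra_simps)
  then have "plane_rotation c (- s) i j ** plane_rotation c s i j = mat 1"
    by (simp add: vec_eq_iff)
  then show ?thesis
    by (simp add: orthogonal_matrix transpose_plane_rotation[OF assms(1)])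
qed

lemma continuous_row_minor: "continuous_on UNIV (row_minor f)"
  unfolding row_minor_def det_def by (intro continuous_intros)

lemma borel_measurable_row_minor [measurable]: "row_minor f \<in> borel_measurable borel"
  by (rule borel_measurable_continuous_onI[OF continuous_row_minor])

lemma borel_measurable_matrix_mult_left [measurable]:
  fixes U :: "real ^ 'n ^ 'm"
  shows "(\<lambda>X :: real ^ 'l ^ 'n. U ** X) \<in> borel_measurable borel"
  unfolding matrix_matrix_mult_def
  by (intro borel_measurable_continuous_onI continuous_intros)

text \<open>The three square matrices agree in all rows except \<open>a\<close>, and the determinant
  is linear in that row.\<close>

lemma row_minor_upd_linear:
  fixes X Y :: "real ^ 'l ^ 'n"
  assumes "\<And>b. b \<noteq> a \<Longrightarrow> Y $ f b = X $ f b" and "Y $ f a = u *\<^sub>R X $ f a + v *\<^sub>R X $ j"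
  shows "row_minor f Y = u * row_minor f X + v * row_minor (f(a := j)) X"
proof -
  have "row_minor f Y =
      det (\<chi> b. if b = a then u *s (X $ f a) + v *s (X $ j) else X $ f b)"
    unfolding row_minor_def using assms
    by (intro arg_cong[of _ _ det]) (auto simp: vec_eq_iff)
  also have "\<dots> = u * det (\<chi> b. if b = a then X $ f a else X $ f b)
      + v * det (\<chi> b. if b = a then X $ j else X $ f b)"
    by (simp only: det_row_add det_row_mul)
  also have "(\<chi> b. if b = a then X $ f a else X $ f b) = (\<chi> b. X $ f b)"
    by (auto simp: vec_eq_iff)
  also have "(\<chi> b. if b = a then X $ j else X $ f b) = (\<chi> b. X $ (f(a := j)) b)"
    by (auto simp: vec_eq_iff)
  finally show ?thesis
    by (simp add: row_minor_def)
qed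

text \<open>The rotation alters only the rows \<open>f a\<close> and \<open>j\<close>, and each of
  the two selections contains exactly one of them, so linearity in that row suffices.\<close>

lemma row_minor_plane_rotation:
  fixes X :: "real ^ 'l ^ 'n"
  assumes "inj f" and "j \<notin> range f"
  shows "row_minor f (plane_rotation c s (f a) j ** X) =
      c * row_minor f X + s * row_minor (f(a := j)) X"
    and "row_minor (f(a := j)) (plane_rotation c s (f a) j ** X) =
      c * row_minor (f(a := j)) X - s * row_minor f X"
proof -
  have neq: "f a \<noteq> j" "\<And>b. f b \<noteq> j"
    using assms(2) by auto
  have other: "b \<noteq> a \<Longrightarrow> f b \<noteq> f a" for b
    using assms(1) by (auto dest: injD)
  show "row_minor f (plane_rotation c s (f a) j ** X) =
      c * row_minor f X + s * row_minor (f(a := j)) X"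
    by (rule row_minor_upd_linear) (auto simp: plane_rotation_mult neq other)
  \<comment> \<open>Putting \<open>f a\<close> back at position \<open>a\<close> of
    \<open>f(a := j)\<close> restores \<open>f\<close>, so the linearity lemma applies with the two
    rows in exchanged roles.\<close>
  have "row_minor (f(a := j)) (plane_rotation c s (f a) j ** X) =
      c * row_minor (f(a := j)) X + (- s) * row_minor ((f(a := j))(a := f a)) X"
    by (rule row_minor_upd_linear) (use neq in \<open>auto simp: plane_rotation_mult other\<close>)
  then show "row_minor (f(a := j)) (plane_rotation c s (f a) j ** X) =
      c * row_minor (f(a := j)) X - s * row_minor f X"
    by simp
qed

section \<open>Almost sure exchange of rows\<close>

text \<open>Countable additivity makes the constant series with terms \<open>p\<close> converge,
  which forces \<open>p = 0\<close>.\<close>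

lemma (in finite_measure) null_of_disjoint_equimeasurable:
  fixes F :: "nat \<Rightarrow> 'a set"
  assumes "range F \<subseteq> sets M" and "disjoint_family F" and "\<And>k. measure M (F k) = p"
  shows "p = 0"
  using finite_measure_UNION[OF assms(1,2)] assms(3)
  by (simp add: sums_iff summable_const_iff)

lemma AE_row_minor_exchange:
  fixes Q :: "'a \<Rightarrow> real ^ 'l ^ 'n"
  assumes "prob_space M" and Q: "random_orthonormal M Q" and "inj f" and "j \<notin> range f"
  shows "AE \<omega> in M. row_minor (f(a := j)) (Q \<omega>) \<noteq> 0 \<longrightarrow> row_minor f (Q \<omega>) \<noteq> 0"
proof -
  interpret prob_space M by fact
  have [measurable]: "Q \<in> borel_measurable M"
    using Q by (simp add: random_orthonormal_def)
  define B where "B = {X :: real ^ 'l ^ 'n. row_minor f X = 0 \<and> row_minor (f(a := j)) X \<noteq> 0}"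
  have [measurable]: "B \<in> sets borel"
    unfolding B_def by measurable
  \<comment> \<open>The vector \<open>(c k, k * c k)\<close> is the unit vector of slope
    \<open>k\<close>, so the natural numbers index infinitely many rotations of distinct
    slopes.\<close>
  define c where "c k = 1 / sqrt (1 + (real k)\<^sup>2)" for k
  have c: "c k > 0" "(c k)\<^sup>2 + (real k * c k)\<^sup>2 = 1" for k
  proof -
    have pos: "1 + (real k)\<^sup>2 > 0"
      by (simp add: add_pos_nonneg)
    then show "c k > 0"
      by (simp add: c_def)
    have "(c k)\<^sup>2 * (1 + (real k)\<^sup>2) = 1"
      using pos by (simp add: c_def power_divide)
    then show "(c k)\<^sup>2 + (real k * c k)\<^sup>2 = 1"
      by (simp add: power_mult_distrib algebra_simps)
  qed
  define U where "U k = plane_rotation (c k) (real k * c k) (f a) j" for k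
  define F where "F k = {\<omega> \<in> space M. U k ** Q \<omega> \<in> B}" for k
  have eqv: "measure M (F k) = measure M {\<omega> \<in> space M. Q \<omega> \<in> B}" for k
  proof -
    have "orthogonal_matrix (U k)"
      unfolding U_def using assms(4) c by (intro orthogonal_plane_rotation) auto
    then have "measure (distr M borel (\<lambda>\<omega>. U k ** Q \<omega>)) B = measure (distr M borel Q) B"
      using Q by (simp add: random_orthonormal_def)
    then show ?thesis
      by (simp add: measure_distr F_def vimage_def Int_def conj_commute)
  qed
  have "disjoint_family F"
  proof -
    have "k = m" if "\<omega> \<in> F k" "\<omega> \<in> F m" for k m \<omega>
    proof -
      let ?x = "row_minor f (Q \<omega>)" and ?y = "row_minor (f(a := j)) (Q \<omega>)"
      \<comment> \<open>The first rotated minor vanishes, which puts \<open>(?x, ?y)\<close> on a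
        line through the origin; the second does not, which excludes the origin itself. Lines for
        different indices meet only there, hence the disjointness.\<close>
      have line: "?x + real i * ?y = 0 \<and> (?x \<noteq> 0 \<or> ?y \<noteq> 0)" if "\<omega> \<in> F i" for i
      proof -
        have "c i * ?x + (real i * c i) * ?y = 0" "c i * ?y - (real i * c i) * ?x \<noteq> 0"
          using that by (simp_all add: F_def B_def U_def row_minor_plane_rotation[OF assms(3,4)])
        moreover have "c i * ?x + (real i * c i) * ?y = c i * (?x + real i * ?y)"
          by (simp add: algebra_simps)
        ultimately show ?thesis
          using c(1)[of i] by auto
      qed
      have "(real k - real m) * ?y = 0"
        using line[OF that(1)] line[OF that(2)] unfolding left_diff_distrib by linarith
      moreover have "?y \<noteq> 0"
        using line[OF that(1)] by auto
      ultimately show ?thesis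
        by simp
    qed
    then show ?thesis
      by (auto simp: disjoint_family_on_def)
  qed
  moreover have "range F \<subseteq> sets M"
    unfolding F_def by auto
  ultimately have "measure M {\<omega> \<in> space M. Q \<omega> \<in> B} = 0"
    using null_of_disjoint_equimeasurable[of F] eqv by blast
  then have "AE \<omega> in M. Q \<omega> \<notin> B"
    by (subst AE_iff_measurable[of "{\<omega> \<in> space M. Q \<omega> \<in> B}"]) (auto simp: emeasure_eq_measure)
  then show ?thesis
    by eventually_elim (auto simp: B_def)
qed

section \<open>A first nonzero minor, and exchanges that reach all sets\<close>

text \<open>Left invertibility makes the rows span the whole space, so a basis can be chosen among
  them, and it has \<open>CARD('l)\<close> elements.\<close>

lemma left_invertible_imp_row_minor_nonzero:
  fixes X :: "real ^ 'l ^ 'n"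
  assumes "L ** X = mat 1"
  obtains f where "inj f" and "row_minor f X \<noteq> 0"
proof -
  have "span (rows X) = UNIV"
    using assms matrix_left_invertible_span_rows by blast
  moreover obtain B where B: "B \<subseteq> rows X" "independent B" "rows X \<subseteq> span B"
    using maximal_independent_subset by blast
  ultimately have span: "span B = UNIV"
    by (metis span_mono span_span top.extremum_uniqueI)
  then have "card B = CARD('l)"
    using B(2) by (metis dim_UNIV dim_eq_card_independent dim_span DIM_cart DIM_real mult_1_right)
  moreover have "finite B"
    using B(2) independent_imp_finite by blast
  ultimately obtain h where h: "bij_betw h (UNIV :: 'l set) B"
    using finite_same_card_bij[of "UNIV :: 'l set" B] by auto
  have "h a \<in> rows X" for a
    using h B(1) by (auto simp: bij_betw_def)
  then have "\<exists>i. h a = row i X" for a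
    by (simp add: rows_def)
  \<comment> \<open>The basis is a set of vectors, while a minor needs row indices; \<open>f\<close>
    chooses one index for each vector and inherits injectivity from \<open>h\<close>.\<close>
  then obtain f where f: "\<And>a. h a = row (f a) X"
    by metis
  have "inj f"
    using h f by (metis bij_betw_def injD injI)
  moreover have "row_minor f X \<noteq> 0"
  proof -
    let ?A = "\<chi> a. X $ f a"
    have "row a ?A = h a" for a
      using f[of a] by (simp add: row_def)
    then have "rows ?A = B"
      using h by (auto simp: rows_def bij_betw_def)
    then have "invertible ?A"
      using span by (simp add: invertible_left_inverse matrix_left_invertible_span_rows)
    then show ?thesis
      by (simp add: row_minor_def invertible_det_nz)
  qed
  ultimately show ?thesis
    using that by blast
qed

text \<open>While \<open>S\<close> differs from \<open>T\<close>, equal cardinality makes both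
  \<open>S - T\<close> and \<open>T - S\<close> nonempty; exchanging an element of the first for one
  of the second shrinks \<open>T - S\<close>.\<close>

lemma exchange_closed_imp_all:
  fixes P :: "'n::finite set \<Rightarrow> bool"
  assumes "P S" and "card S = card T"
    and exchange: "\<And>S i j. P S \<Longrightarrow> i \<in> S \<Longrightarrow> j \<notin> S \<Longrightarrow> P (insert j (S - {i}))"
  shows "P T"
  using assms(1,2)
proof (induction "card (T - S)" arbitrary: S rule: less_induct)
  case less
  show ?case
  proof (cases "S = T")
    case True
    then show ?thesis using less.prems by simp
  next
    case False
    then have "\<not> T \<subseteq> S" "\<not> S \<subseteq> T"
      using less.prems(2) by (metis card_subset_eq finite)+
    then obtain i j where ij: "i \<in> S" "i \<notin> T" "j \<in> T" "j \<notin> S"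
      by blast
    let ?S = "insert j (S - {i})"
    have "T - ?S \<subset> T - S"
      using ij by blast
    then have "card (T - ?S) < card (T - S)"
      by (simp add: psubset_card_mono)
    moreover have "card ?S = card T"
      using ij less.prems(2) card_Suc_Diff1[of S i] by simp
    ultimately show ?thesis
      using less.hyps less.prems(1) exchange ij by blast
  qed
qed

section \<open>From nonzero minors to the spark\<close>

text \<open>The columns of the transpose are the rows of \<open>X\<close>. A nonzero determinant
  excludes equal rows and makes the selected rows span, and a spanning set of
  \<open>CARD('l)\<close> vectors is independent.\<close>

lemma independent_columns_of_row_minor:
  fixes X :: "real ^ 'l ^ 'n"
  assumes "row_minor f X \<noteq> 0"
  shows "independent_columns (transpose X) (range f)"
proof -
  let ?A = "\<chi> a. X $ f a"
  have det: "det ?A \<noteq> 0"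
    using assms by (simp add: row_minor_def)
  have row: "row a ?A = row (f a) X" for a
    by (simp add: row_def)
  have "inj_on (\<lambda>i. row i X) (range f)"
    using det_identical_rows[of _ _ ?A] det row by (auto simp: inj_on_def) metis
  moreover have "(\<lambda>i. row i X) ` range f = rows ?A"
    using row by (auto simp: rows_def)
  moreover have "independent (rows ?A)"
  proof -
    have "span (rows ?A) = UNIV"
      using det by (simp add: invertible_det_nz[symmetric] invertible_left_inverse
          matrix_left_invertible_span_rows)
    moreover have "inj (\<lambda>a. row a ?A)"
      using det_identical_rows[of _ _ ?A] det by (auto simp: inj_def)
    then have "card (rows ?A) = CARD('l)"
      by (simp add: rows_def full_SetCompr_eq card_image)
    ultimately show ?thesis
      using card_eq_dim[of "rows ?A" UNIV] by (simp add: rows_def full_SetCompr_eq)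
  qed
  ultimately show ?thesis
    by (simp add: independent_columns_def)
qed

lemma independent_columns_mono:
  assumes "independent_columns A T" and "S \<subseteq> T"
  shows "independent_columns A S"
  using assms unfolding independent_columns_def
  by (meson image_mono independent_mono inj_on_subset)

lemma independent_columns_card_le:
  fixes A :: "real ^ 'c ^ 'r"
  assumes "independent_columns A S"
  shows "card S \<le> CARD('r)"
  using assms independent_bound[of "(\<lambda>j. column j A) ` S"]
  by (simp add: independent_columns_def card_image)

text \<open>A smaller set of columns extends to one of size \<open>CARD('r)\<close>, which
  \<open>le\<close> makes possible, and inherits its independence. A larger set is dependent by
  dimension.\<close>

lemma spark_eq_full:
  fixes A :: "real ^ 'c ^ 'r"
  assumes le: "CARD('r) \<le> CARD('c)"
    and indep: "\<And>S. card S = CARD('r) \<Longrightarrow> independent_columns A S"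
  shows "spark A = CARD('r) + 1"
proof -
  have small: "independent_columns A S" if "card S \<le> CARD('r)" for S
  proof -
    have "\<exists>T. S \<subseteq> T \<and> T \<subseteq> UNIV \<and> card T = CARD('r)"
      using that le by (intro exists_subset_between) auto
    then show ?thesis
      using indep independent_columns_mono by blast
  qed
  show ?thesis
  proof (cases "CARD('r) = CARD('c)")
    case True
    \<comment> \<open>For a square matrix no dependent set is left, so the value comes from the
      convention in \<open>spark\<close>.\<close>
    then have "independent_columns A S" for S
      by (simp add: small card_mono)
    then show ?thesis
      using True by (simp add: spark_def)
  next
    case False
    then obtain S :: "'c set" where S: "card S = CARD('r) + 1"
      using le obtain_subset_with_card_n[of "CARD('r) + 1" "UNIV :: 'c set"] by auto
    then have dep: "\<not> independent_columns A S"
      using independent_columns_card_le[of A S] by auto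
    have "(LEAST k. \<exists>S. card S = k \<and> \<not> independent_columns A S) = CARD('r) + 1"
      using S dep small by (intro Least_equality) (auto simp: not_less_eq_eq[symmetric])
    then show ?thesis
      using dep by (auto simp: spark_def)
  qed
qed

theorem lemmaE7:
  fixes M :: "'a measure"
    and Q :: "'a \<Rightarrow> real ^ 'l ^ 'n"
    and p_sketch :: real
  assumes "prob_space M"
    and "0 < p_sketch" and "p_sketch \<le> 1"
    and "int CARD('l) = \<lceil>p_sketch * real CARD('n)\<rceil>"
    and "random_orthonormal M Q"
  shows "AE \<omega> in M.
           (\<forall>S. card S = CARD('l) \<longrightarrow> independent_columns (transpose (Q \<omega>)) S) \<and>
           spark (transpose (Q \<omega>)) = CARD('l) + 1"
proof -
  have "p_sketch * real CARD('n) \<le> real CARD('n)"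
    using assms(3) by (simp add: mult_left_le_one_le assms(2) less_imp_le)
  then have le: "CARD('l) \<le> CARD('n)"
    using assms(4) by linarith
  \<comment> \<open>There are only finitely many choices of \<open>f\<close>, \<open>a\<close> and
    \<open>j\<close>, so one null set serves for all of them.\<close>
  have "AE \<omega> in M. \<forall>f \<in> {f :: 'l \<Rightarrow> 'n. inj f}. \<forall>a. \<forall>j \<in> - range f.
      row_minor (f(a := j)) (Q \<omega>) \<noteq> 0 \<longrightarrow> row_minor f (Q \<omega>) \<noteq> 0"
    using AE_row_minor_exchange[OF assms(1,5)]
    by (intro AE_finite_allI AE_all_countable[THEN iffD2] allI) auto
  moreover have "AE \<omega> in M. transpose (Q \<omega>) ** Q \<omega> = mat 1"
    using assms(5) by (simp add: random_orthonormal_def)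
  ultimately show ?thesis
  proof eventually_elim
    case (elim \<omega>)
    let ?X = "Q \<omega>"
    \<comment> \<open>The existential quantifier forgets the order of the rows, which turns exchange
      into a property of sets.\<close>
    define P where "P S \<longleftrightarrow> (\<exists>f. inj f \<and> range f = S \<and> row_minor f ?X \<noteq> 0)" for S
    have exchange: "P (insert j (S - {i}))" if "P S" "i \<in> S" "j \<notin> S" for S i j
    proof -
      obtain f where f: "inj f" "range f = S" "row_minor f ?X \<noteq> 0"
        using \<open>P S\<close> by (auto simp: P_def)
      then obtain a where a: "f a = i"
        using \<open>i \<in> S\<close> by auto
      let ?g = "f(a := j)"
      have inj: "inj ?g"
        using f \<open>j \<notin> S\<close> by (auto simp: inj_on_def)
      have range: "range ?g = insert j (S - {i})"
        using f(1,2) a by (auto simp: fun_upd_image dest: injD)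
      \<comment> \<open>The almost sure implication leads from the updated selection to the original
        one. It is therefore applied to \<open>?g\<close>, whose update at \<open>a\<close> by
        \<open>i\<close> is \<open>f\<close>.\<close>
      have "i \<notin> range ?g"
        using \<open>i \<in> S\<close> \<open>j \<notin> S\<close> range by auto
      moreover have "?g(a := i) = f"
        using a by auto
      ultimately have "row_minor ?g ?X \<noteq> 0"
        using elim(1) inj f(3) by (metis ComplI mem_Collect_eq)
      then show ?thesis
        using inj range unfolding P_def by blast
    qed
    obtain f :: "'l \<Rightarrow> 'n" where f: "inj f" "row_minor f ?X \<noteq> 0"
      using left_invertible_imp_row_minor_nonzero[OF elim(2)] .
    then have start: "P (range f)" "card (range f) = CARD('l)"
      by (auto simp: P_def card_image)
    have indep: "independent_columns (transpose ?X) S" if "card S = CARD('l)" for S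
    proof -
      have "P S"
        by (rule exchange_closed_imp_all[of P, OF start(1)]) (use start that exchange in auto)
      then show ?thesis
        using independent_columns_of_row_minor by (auto simp: P_def)
    qed
    then show ?case
      using spark_eq_full[OF le, of "transpose ?X"] by blast
  qed
qed

end
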